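(* Let $Y$ be a summation method (satisfying axioms (A), (B), (C)) that assigns a finite real number to the constant sequence $(1,1,1,1,\dots)$, i.e. to the formal series $1+1+1+1+\cdots$. Then (i) $Y$ is not totally regular; (ii) $Y$ is not regular; and (iii) $Y$ is contradictory.
   Context: Sequences are real sequences $a=(a_0,a_1,a_2,\dots)$. A summation method $Y$ assigns values in $\mathbb{R}\cup\{+\infty,-\infty\}$ to some real sequences; formally, treat $Y$ as a relation between real sequences and values, writing $Y(a)=s$ for "$Y$ assigns $s$ to $a$" (uniqueness of the assigned value is the intended requirement on a method, but its failure is exactly what "contradictory" below expresses, so it is not built into the relation). Every method is assumed to satisfy the following axioms, for all real sequences $a,b$ and all real $s,r$ (finite values): (A) for every real $k$: $Y(a)=s$ implies $Y(ka_0,ka_1,ka_2,\dots)=ks$; (B) $Y(a)=s$ and $Y(b)=r$ imply $Y(a_0+b_0,a_1+b_1,a_2+b_2,\dots)=s+r$; (C) $Y(a_0,a_1,a_2,\dots)=s$ if and only if $Y(a_1,a_2,a_3,\dots)=s-a_0$. $Y$ is regular if, for every sequence $a$ whose series $\sum_n a_n$ converges in the usual sense to a real number $s$, $Y$ assigns a value to $a$ and the only value it assigns is $s$. $Y$ is totally regular if it is regular and, for every sequence $a$ whose partial sums tend to $+\infty$ (respectively $-\infty$), $Y$ assigns to $a$ the value $+\infty$ (respectively $-\infty$) and no other value. $Y$ is contradictory if there are a real sequence $a$ and real numbers $r\neq s$ such that both $Y(a)=r$ and $Y(a)=s$ hold. *)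

theory Defs
  imports Complex_Main "HOL-Library.Extended_Real"
begin

text \<open>A method is a relation, not a function: uniqueness of the assigned value is not built in.\<close>

type_synonym assignment = "(nat \<Rightarrow> real) \<Rightarrow> ereal \<Rightarrow> bool"

text \<open>The axioms constrain finite values only.\<close>

definition summation_method :: "assignment \<Rightarrow> bool" where
  "summation_method Y \<longleftrightarrow>
     (\<forall>a s k. Y a (ereal s) \<longrightarrow> Y (\<lambda>n. k * a n) (ereal (k * s))) \<and>
     (\<forall>a b s r. Y a (ereal s) \<and> Y b (ereal r) \<longrightarrow> Y (\<lambda>n. a n + b n) (ereal (s + r))) \<and>
     (\<forall>a s. Y a (ereal s) \<longleftrightarrow> Y (\<lambda>n. a (Suc n)) (ereal (s - a 0)))"

definition assigns_only :: "assignment \<Rightarrow> (nat \<Rightarrow> real) \<Rightarrow> ereal \<Rightarrow> bool" where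
  "assigns_only Y a v \<longleftrightarrow> Y a v \<and> (\<forall>w. Y a w \<longrightarrow> w = v)"

definition regular :: "assignment \<Rightarrow> bool" where
  "regular Y \<longleftrightarrow> (\<forall>a s. a sums s \<longrightarrow> assigns_only Y a (ereal s))"

definition totally_regular :: "assignment \<Rightarrow> bool" where
  "totally_regular Y \<longleftrightarrow>
     regular Y \<and>
     (\<forall>a. filterlim (\<lambda>n. \<Sum>k\<le>n. a k) at_top sequentially \<longrightarrow> assigns_only Y a \<infinity>) \<and>
     (\<forall>a. filterlim (\<lambda>n. \<Sum>k\<le>n. a k) at_bot sequentially \<longrightarrow> assigns_only Y a (-\<infinity>))"

definition contradictory :: "assignment \<Rightarrow> bool" where
  "contradictory Y \<longleftrightarrow> (\<exists>a r s. r \<noteq> s \<and> Y a (ereal r) \<and> Y a (ereal s))"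

end

theory Submission
  imports Defs
begin

text \<open>Deleting the first term of \<open>1 + 1 + 1 + \<dots>\<close> leaves the same series, so a value \<open>s\<close> forces the
  second value \<open>s - 1\<close>. The difference of two distinct values of one series is a nonzero value of
  \<open>0 + 0 + 0 + \<dots>\<close>, which regularity forbids.\<close>

lemma contradictory_if_assigns_ones:
  assumes Y: "summation_method Y" and s: "Y (\<lambda>_. 1) (ereal s)"
  shows "contradictory Y"
proof -
  have shift: "Y a (ereal r) \<Longrightarrow> Y (\<lambda>n. a (Suc n)) (ereal (r - a 0))" for a r
    using Y unfolding summation_method_def by blast
  have "Y (\<lambda>_. 1) (ereal (s - 1))"
    using shift[OF s] by simp
  moreover have "s - 1 \<noteq> s"
    by simp
  ultimately show ?thesis
    using s unfolding contradictory_def by blast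
qed

text \<open>Linearity, that is axioms (A) and (B), moves the ambiguity from \<open>a\<close>, which
  may diverge, to the zero sequence, which converges and so is within reach of regularity.\<close>

lemma contradictory_imp_not_regular:
  assumes Y: "summation_method Y" and "contradictory Y"
  shows "\<not> regular Y"
proof
  assume "regular Y"
  obtain a r s where "r \<noteq> s" and r: "Y a (ereal r)" and s: "Y a (ereal s)"
    using \<open>contradictory Y\<close> unfolding contradictory_def by blast
  have scale: "Y (\<lambda>n. k * a n) (ereal (k * s))" for k
    using Y s unfolding summation_method_def by blast
  have add: "Y b (ereal t) \<Longrightarrow> Y (\<lambda>n. a n + b n) (ereal (r + t))" for b t
    using Y r unfolding summation_method_def by blast
  \<comment> \<open>Take \<open>k = -1\<close>: the value \<open>r\<close> of \<open>a\<close> is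
    added to the value \<open>-s\<close> of \<open>-a\<close>, and the terms cancel.\<close>
  have "Y (\<lambda>_. 0) (ereal (r - s))"
    using add[OF scale[of "-1"]] by simp
  moreover have "assigns_only Y (\<lambda>_. 0) (ereal 0)"
    using \<open>regular Y\<close> sums_zero unfolding regular_def by blast
  ultimately have "ereal (r - s) = ereal 0"
    unfolding assigns_only_def by blast
  with \<open>r \<noteq> s\<close> show False
    by simp
qed

theorem theorem1:
  fixes Y :: "(nat \<Rightarrow> real) \<Rightarrow> ereal \<Rightarrow> bool"
  assumes "summation_method Y"
    and "\<exists>s::real. Y (\<lambda>_. 1) (ereal s)"
  shows "\<not> totally_regular Y \<and> \<not> regular Y \<and> contradictory Y"
proof -
  have "contradictory Y"
    using assms contradictory_if_assigns_ones by blast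
  moreover from this have "\<not> regular Y"
    using assms(1) contradictory_imp_not_regular by blast
  \<comment> \<open>Total regularity includes regularity, so it fails as well.\<close>
  ultimately show ?thesis
    unfolding totally_regular_def by blast
qed

end
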